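(* Let $m,n\ge2$ and $k\ge1$ be integers with $mn>k$. Suppose there exists a symmetric association scheme with 7 classes whose first and second eigenmatrices (for some ordering $A_0,\dots,A_7$ of the adjacency matrices and $E_0,\dots,E_7$ of the primitive idempotents) are $$P=\begin{pmatrix} 1 & 1 & 2 (n-1) & 2 (m-1) n & k & k & 2 (-k+m n-n) & 2 n \\ 1 & -1 & 0 & 0 & \sqrt{k} & -\sqrt{k} & 0 & 0 \\ 1 & 1 & 2 (n-1) & -2 n & \frac{k}{1-m} & \frac{k}{1-m} & \frac{2 (k-m n+n)}{m-1} & 2 n \\ 1 & 1 & 2 (n-1) & -2 n & \frac{k}{m-1} & \frac{k}{m-1} & -\frac{2 (k-m n+n)}{m-1} & -2 n \\ 1 & -1 & 0 & 0 & -\sqrt{k} & \sqrt{k} & 0 & 0 \\ 1 & 1 & 2 (n-1) & 2 (m-1) n & -k & -k & 2 (k-m n+n) & -2 n \\ 1 & 1 & -2 & 0 & -\frac{\sqrt{k(m n-n-k)}}{ \sqrt{(m-1)(n-1)}} & -\frac{\sqrt{k(m n-n-k)}}{ \sqrt{(m-1)(n-1)}} & \frac{2\sqrt{k(m n-n-k)}}{ \sqrt{(m-1)(n-1)}} & 0 \\ 1 & 1 & -2 & 0 & \frac{\sqrt{k(m n-n-k)}}{ \sqrt{(m-1)(n-1)}} & \frac{\sqrt{k(m n-n-k)}}{ \sqrt{(m-1)(n-1)}} & -\frac{2\sqrt{k(m n-n-k)}}{ \sqrt{(m-1)(n-1)}} & 0 \end{pmatrix},$$ $$Q=\begin{pmatrix}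 1 & m n & m-1 & m-1 & m n & 1 & m (n-1) & m (n-1) \\ 1 & -m n & m-1 & m-1 & -m n & 1 & m (n-1) & m (n-1) \\ 1 & 0 & m-1 & m-1 & 0 & 1 & -m & -m \\ 1 & 0 & -1 & -1 & 0 & 1 & 0 & 0 \\ 1 & \frac{m n}{\sqrt{k}} & -1 & 1 & -\frac{m n}{\sqrt{k}} & -1 & -\frac{m \sqrt{(n-1)(mn-n-k)}}{\sqrt{k(m-1)}} & \frac{m \sqrt{(n-1)(mn-n-k)}}{\sqrt{k(m-1)}} \\ 1 & -\frac{m n}{\sqrt{k}} & -1 & 1 & \frac{m n}{\sqrt{k}} & -1 & -\frac{m \sqrt{(n-1)(mn-n-k)}}{\sqrt{k(m-1)}} & \frac{m \sqrt{(n-1)(mn-n-k)}}{\sqrt{k(m-1)}} \\ 1 & 0 & -1 & 1 & 0 & -1 & \frac{m \sqrt{k(n-1)}}{ \sqrt{(m-1)(mn-n-k)}} & -\frac{m \sqrt{k(n-1)}}{ \sqrt{(m-1)(mn-n-k)}} \\ 1 & 0 & m-1 & -m+1 & 0 & -1 & 0 & 0 \end{pmatrix}.$$ Then there exists a quasi-balanced weighing matrix $W$ such that $|W|$ is the incidence matrix of a symmetric group divisible design with parameters $(v,k,m,n,\lambda_1,\lambda_2)$, where $v=mn$, for some $\lambda_1,\lambda_2$, and such that $|W|\,\mathcal J_{m,n}=\mathcal J_{m,n}\,|W|=\frac{k}{m-1}(J_v-\mathcal J_{m,n})$.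
   Context: $I_r$, $J_r$ are the identity and all-ones matrices of order $r$, and $\mathcal J_{m,n}=I_m\otimes J_n$. A weighing matrix of order $v$ and weight $k$ is a $v\times v$ matrix $W$ with entries in $\{0,1,-1\}$ satisfying $WW^\top=kI_v$. $|W|$ is its entrywise absolute value. $W$ is quasi-balanced if $|W|\,|W|^\top=|W|^\top|W|$ and the off-diagonal entries of $|W|\,|W|^\top$ take at most two distinct values. For $m,n\ge2$ and $v=mn$, a $v\times v$ $(0,1)$-matrix $A$ is (the incidence matrix of) a symmetric group divisible design with parameters $(v,k,m,n,\lambda_1,\lambda_2)$ if $$AA^\top=A^\top A=kI_v+\lambda_1(\mathcal J_{m,n}-I_v)+\lambda_2(J_v-\mathcal J_{m,n}).$$ A symmetric association scheme with $d$ classes on a finite set $X$ is a set of nonzero $(0,1)$-matrices $A_0,\dots,A_d$ indexed by $X$ with $A_0=I$, $\sum_i A_i=J$, $A_i^\top=A_i$, and $A_iA_j=\sum_{h} p_{ij}^hA_h$ for non-negative integers $p_{ij}^h$. Its Bose–Mesner algebra (the complex span of the $A_i$) has a basis of primitive idempotents $E_0=\frac1{|X|}J,E_1,\dots,E_d$, and the first and second eigenmatrices $P,Q$ (rows and columns indexed from $0$ to $d$) are defined by $A_j=\sum_i P_{ij}E_i$ and $E_j=\frac1{|X|}\sum_i Q_{ij}A_i$. *)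

theory Defs
  imports "HOL-Analysis.Analysis"
begin

definition all_ones :: "'a::semiring_1 ^ 'c ^ 'r" where
  "all_ones = (\<chi> i j. 1)"

definition kronecker_mat ::
    "'a::semiring_1 ^ 'c1 ^ 'r1 \<Rightarrow> 'a ^ 'c2 ^ 'r2 \<Rightarrow> 'a ^ ('c1 \<times> 'c2) ^ ('r1 \<times> 'r2)" where
  "kronecker_mat A B = (\<chi> i j. A $ fst i $ fst j * B $ snd i $ snd j)"

text \<open>The matrix \<open>I\<^sub>m \<otimes> J\<^sub>n\<close>, where \<open>m\<close> and \<open>n\<close> are the cardinalities of the two index types.
  Matrices of order \<open>v = m * n\<close> on which it acts have rows and columns indexed by \<open>'m \<times> 'n\<close>.\<close>

definition block_J :: "real ^ ('m::finite \<times> 'n::finite) ^ ('m \<times> 'n)" where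
  "block_J = kronecker_mat (mat 1 :: real ^ 'm ^ 'm) (all_ones :: real ^ 'n ^ 'n)"


definition weighing_matrix :: "nat \<Rightarrow> real ^ 'v ^ 'v::finite \<Rightarrow> bool" where
  "weighing_matrix k W \<longleftrightarrow>
     (\<forall>i j. W $ i $ j \<in> {0, 1, -1}) \<and> W ** transpose W = real k *\<^sub>R mat 1"

text \<open>On \<open>real ^ 'v ^ 'v\<close> the library's \<open>\<bar>W\<bar>\<close> is the entrywise absolute value, see \<open>abs_mat_nth\<close>.\<close>

lemma abs_mat_nth: "\<bar>W :: real ^ 'c::finite ^ 'r::finite\<bar> $ i $ j = \<bar>W $ i $ j\<bar>"
  by (simp add: abs_vec_def)

definition quasi_balanced :: "real ^ 'v ^ 'v::finite \<Rightarrow> bool" where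
  "quasi_balanced W \<longleftrightarrow>
     \<bar>W\<bar> ** transpose \<bar>W\<bar> = transpose \<bar>W\<bar> ** \<bar>W\<bar> \<and>
     card {(\<bar>W\<bar> ** transpose \<bar>W\<bar>) $ i $ j | i j. i \<noteq> j} \<le> 2"

definition symmetric_gdd ::
    "nat \<Rightarrow> nat \<Rightarrow> nat \<Rightarrow> nat \<Rightarrow> nat \<Rightarrow> nat \<Rightarrow> real ^ ('m::finite \<times> 'n::finite) ^ ('m \<times> 'n) \<Rightarrow> bool" where
  "symmetric_gdd v k m n l1 l2 A \<longleftrightarrow>
     m = CARD('m) \<and> n = CARD('n) \<and> 2 \<le> m \<and> 2 \<le> n \<and> v = m * n \<and>
     (\<forall>i j. A $ i $ j \<in> {0, 1}) \<and>
     A ** transpose A =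
       real k *\<^sub>R mat 1 + real l1 *\<^sub>R (block_J - mat 1) + real l2 *\<^sub>R (all_ones - block_J) \<and>
     transpose A ** A =
       real k *\<^sub>R mat 1 + real l1 *\<^sub>R (block_J - mat 1) + real l2 *\<^sub>R (all_ones - block_J)"


definition cscale_mat :: "complex \<Rightarrow> complex ^ 'c ^ 'r \<Rightarrow> complex ^ 'c ^ 'r" (infixr "\<odot>" 75) where
  "c \<odot> A = (\<chi> i j. c * A $ i $ j)"

text \<open>The finite set \<open>X\<close> is the index type \<open>'x\<close>; only \<open>A 0, \<dots>, A d\<close> matter.\<close>

definition symmetric_association_scheme :: "nat \<Rightarrow> (nat \<Rightarrow> complex ^ 'x ^ 'x::finite) \<Rightarrow> bool" where
  "symmetric_association_scheme d A \<longleftrightarrow>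
     (\<forall>i\<le>d. A i \<noteq> 0 \<and> (\<forall>x y. A i $ x $ y \<in> {0, 1})) \<and>
     A 0 = mat 1 \<and>
     (\<Sum>i\<le>d. A i) = all_ones \<and>
     (\<forall>i\<le>d. transpose (A i) = A i) \<and>
     (\<exists>p :: nat \<Rightarrow> nat \<Rightarrow> nat \<Rightarrow> nat.
        \<forall>i\<le>d. \<forall>j\<le>d. A i ** A j = (\<Sum>h\<le>d. of_nat (p i j h) \<odot> A h))"

definition mat_span :: "nat \<Rightarrow> (nat \<Rightarrow> complex ^ 'x ^ 'x::finite) \<Rightarrow> (complex ^ 'x ^ 'x) set" where
  "mat_span d A = {\<Sum>i\<le>d. c i \<odot> A i | c :: nat \<Rightarrow> complex. True}"

definition mat_independent :: "nat \<Rightarrow> (nat \<Rightarrow> complex ^ 'x ^ 'x::finite) \<Rightarrow> bool" where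
  "mat_independent d A \<longleftrightarrow>
     (\<forall>c :: nat \<Rightarrow> complex. (\<Sum>i\<le>d. c i \<odot> A i) = 0 \<longrightarrow> (\<forall>i\<le>d. c i = 0))"

definition bose_mesner_algebra :: "nat \<Rightarrow> (nat \<Rightarrow> complex ^ 'x ^ 'x::finite) \<Rightarrow> (complex ^ 'x ^ 'x) set" where
  "bose_mesner_algebra d A = mat_span d A"

text \<open>A nonzero idempotent of the algebra \<open>S\<close> that is not a sum of two nonzero orthogonal
  idempotents of \<open>S\<close>.\<close>

definition primitive_idempotent :: "(complex ^ 'x ^ 'x::finite) set \<Rightarrow> complex ^ 'x ^ 'x \<Rightarrow> bool" where
  "primitive_idempotent S E \<longleftrightarrow>
     E \<in> S \<and> E \<noteq> 0 \<and> E ** E = E \<and>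
     \<not> (\<exists>F\<in>S. \<exists>G\<in>S. F \<noteq> 0 \<and> G \<noteq> 0 \<and> F ** F = F \<and> G ** G = G \<and>
           F ** G = 0 \<and> G ** F = 0 \<and> E = F + G)"

definition primitive_idempotent_basis ::
    "nat \<Rightarrow> (nat \<Rightarrow> complex ^ 'x ^ 'x::finite) \<Rightarrow> (nat \<Rightarrow> complex ^ 'x ^ 'x) \<Rightarrow> bool" where
  "primitive_idempotent_basis d A E \<longleftrightarrow>
     E 0 = (1 / of_nat CARD('x)) \<odot> all_ones \<and>
     (\<forall>i\<le>d. primitive_idempotent (bose_mesner_algebra d A) (E i)) \<and>
     mat_independent d E \<and> mat_span d E = bose_mesner_algebra d A"

definition first_eigenmatrix ::
    "nat \<Rightarrow> (nat \<Rightarrow> complex ^ 'x ^ 'x::finite) \<Rightarrow> (nat \<Rightarrow> complex ^ 'x ^ 'x) \<Rightarrow> (nat \<Rightarrow> nat \<Rightarrow> complex) \<Rightarrow> bool" where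
  "first_eigenmatrix d A E P \<longleftrightarrow> (\<forall>j\<le>d. A j = (\<Sum>i\<le>d. P i j \<odot> E i))"

definition second_eigenmatrix ::
    "nat \<Rightarrow> (nat \<Rightarrow> complex ^ 'x ^ 'x::finite) \<Rightarrow> (nat \<Rightarrow> complex ^ 'x ^ 'x) \<Rightarrow> (nat \<Rightarrow> nat \<Rightarrow> complex) \<Rightarrow> bool" where
  "second_eigenmatrix d A E Q \<longleftrightarrow>
     (\<forall>j\<le>d. E j = (1 / of_nat CARD('x)) \<odot> (\<Sum>i\<le>d. Q i j \<odot> A i))"


text \<open>The two concrete \<open>8 \<times> 8\<close> tables, as lists of rows.\<close>

definition P_rows :: "real \<Rightarrow> real \<Rightarrow> real \<Rightarrow> real list list" where
  "P_rows m n k =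
    (let t = sqrt (k * (m * n - n - k)) / sqrt ((m - 1) * (n - 1)) in
     [[1,  1, 2 * (n - 1), 2 * (m - 1) * n, k, k, 2 * (- k + m * n - n), 2 * n],
      [1, -1, 0, 0, sqrt k, - sqrt k, 0, 0],
      [1,  1, 2 * (n - 1), - 2 * n, k / (1 - m), k / (1 - m), 2 * (k - m * n + n) / (m - 1), 2 * n],
      [1,  1, 2 * (n - 1), - 2 * n, k / (m - 1), k / (m - 1), - (2 * (k - m * n + n) / (m - 1)), - 2 * n],
      [1, -1, 0, 0, - sqrt k, sqrt k, 0, 0],
      [1,  1, 2 * (n - 1), 2 * (m - 1) * n, - k, - k, 2 * (k - m * n + n), - 2 * n],
      [1,  1, -2, 0, - t, - t, 2 * t, 0],
      [1,  1, -2, 0, t, t, - (2 * t), 0]])"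

definition Q_rows :: "real \<Rightarrow> real \<Rightarrow> real \<Rightarrow> real list list" where
  "Q_rows m n k =
    (let a = m * sqrt ((n - 1) * (m * n - n - k)) / sqrt (k * (m - 1));
         b = m * sqrt (k * (n - 1)) / sqrt ((m - 1) * (m * n - n - k)) in
     [[1, m * n, m - 1, m - 1, m * n, 1, m * (n - 1), m * (n - 1)],
      [1, - (m * n), m - 1, m - 1, - (m * n), 1, m * (n - 1), m * (n - 1)],
      [1, 0, m - 1, m - 1, 0, 1, - m, - m],
      [1, 0, -1, -1, 0, 1, 0, 0],
      [1, m * n / sqrt k, -1, 1, - (m * n / sqrt k), -1, - a, a],
      [1, - (m * n / sqrt k), -1, 1, m * n / sqrt k, -1, - a, a],
      [1, 0, -1, 1, 0, -1, b, - b],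
      [1, 0, m - 1, - m + 1, 0, -1, 0, 0]])"

definition table_entry :: "real list list \<Rightarrow> nat \<Rightarrow> nat \<Rightarrow> complex" where
  "table_entry T i j = complex_of_real (T ! i ! j)"

end

(* The idempotents E_i are orthogonal, so every product in the Bose-Mesner algebra can be computed
   by multiplying columns of P entrywise. This shows that A_0 + A_1, A_0 + A_1 + A_2,
   A_0 + ... + A_3 and A_0 + A_1 + A_2 + A_7 are equivalence relations with classes of size
   2, 2n, 2mn and 4n. Hence the 4mn vertices split into two halves, each half into m groups of n
   antipodal pairs, and A_7 matches the groups of one half with those of the other. A_4 - A_5 changes
   sign when a vertex is replaced by its antipode and vanishes inside the halves. Restricted to
   one representative of each antipodal pair, with rows from one half and columns from the other, it
   is W, and the required identities are half of those satisfied by A_4 - A_5 and A_4 + A_5. *)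
theory Submission
  imports Defs
begin

section \<open>Products in the Bose-Mesner algebra and orthogonality of primitive
  idempotents\<close>

lemma cscale_mult_sums:
  fixes F G :: "nat \<Rightarrow> complex ^ 'x ^ 'x::finite"
  shows "(\<Sum>i\<in>I. a i \<odot> F i) ** (\<Sum>j\<in>J. b j \<odot> G j) = (\<Sum>i\<in>I. \<Sum>j\<in>J. (a i * b j) \<odot> (F i ** G j))"
proof -
  have "(\<Sum>u\<in>UNIV. (\<Sum>i\<in>I. a i * F i $ x $ u) * (\<Sum>j\<in>J. b j * G j $ u $ y)) =
        (\<Sum>i\<in>I. \<Sum>j\<in>J. a i * b j * (\<Sum>u\<in>UNIV. F i $ x $ u * G j $ u $ y))" for x y
  proof -
    have "(\<Sum>u\<in>UNIV. (\<Sum>i\<in>I. a i * F i $ x $ u) * (\<Sum>j\<in>J. b j * G j $ u $ y)) =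
          (\<Sum>u\<in>UNIV. \<Sum>i\<in>I. \<Sum>j\<in>J. a i * b j * (F i $ x $ u * G j $ u $ y))"
      by (simp add: sum_product mult_ac)
    also have "\<dots> = (\<Sum>i\<in>I. \<Sum>j\<in>J. \<Sum>u\<in>UNIV. a i * b j * (F i $ x $ u * G j $ u $ y))"
      by (subst sum.swap) (intro sum.cong refl sum.swap)
    finally show ?thesis by (simp add: sum_distrib_left)
  qed
  then show ?thesis by (simp add: vec_eq_iff matrix_matrix_mult_def cscale_mat_def)
qed

text \<open>The product is a combination of symmetric matrices, hence symmetric, while transposing
  it reverses its factors.\<close>

lemma scheme_commute:
  fixes A :: "nat \<Rightarrow> complex ^ 'x ^ 'x::finite"
  assumes "symmetric_association_scheme d A" "i \<le> d" "j \<le> d"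
  shows "A i ** A j = A j ** A i"
proof -
  obtain p :: "nat \<Rightarrow> nat \<Rightarrow> nat \<Rightarrow> nat"
    where p: "\<And>i j. i \<le> d \<Longrightarrow> j \<le> d \<Longrightarrow> A i ** A j = (\<Sum>h\<le>d. of_nat (p i j h) \<odot> A h)"
    using assms(1) unfolding symmetric_association_scheme_def by blast
  have sym: "transpose (A i) = A i" if "i \<le> d" for i
    using assms(1) that unfolding symmetric_association_scheme_def by blast
  have ent: "A h $ y $ x = A h $ x $ y" if "h \<le> d" for h x y
    using arg_cong[OF sym[OF that], of "\<lambda>M. M $ x $ y"] by (simp add: transpose_def)
  have "transpose (A i ** A j) = A i ** A j"
    using p[OF assms(2,3)] ent by (simp add: vec_eq_iff transpose_def cscale_mat_def)
  then show ?thesis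
    using sym assms(2,3) by (metis matrix_transpose_mul)
qed

lemma bose_mesner_algebra_mult:
  assumes "symmetric_association_scheme d A"
    and "F \<in> bose_mesner_algebra d A" "G \<in> bose_mesner_algebra d A"
  shows "F ** G \<in> bose_mesner_algebra d A" "F ** G = G ** F"
proof -
  obtain p :: "nat \<Rightarrow> nat \<Rightarrow> nat \<Rightarrow> nat"
    where p: "\<And>i j. i \<le> d \<Longrightarrow> j \<le> d \<Longrightarrow> A i ** A j = (\<Sum>h\<le>d. of_nat (p i j h) \<odot> A h)"
    using assms(1) unfolding symmetric_association_scheme_def by blast
  obtain a b where F: "F = (\<Sum>i\<le>d. a i \<odot> A i)" and G: "G = (\<Sum>i\<le>d. b i \<odot> A i)"
    using assms(2,3) unfolding bose_mesner_algebra_def mat_span_def by blast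
  have "F ** G = (\<Sum>i\<le>d. \<Sum>j\<le>d. (a i * b j) \<odot> (\<Sum>h\<le>d. of_nat (p i j h) \<odot> A h))"
    by (simp add: F G cscale_mult_sums p)
  also have "\<dots> = (\<Sum>h\<le>d. (\<Sum>i\<le>d. \<Sum>j\<le>d. a i * b j * of_nat (p i j h)) \<odot> A h)"
  proof -
    have "(\<Sum>i\<le>d. \<Sum>j\<le>d. a i * b j * (\<Sum>h\<le>d. of_nat (p i j h) * A h $ x $ y)) =
      (\<Sum>h\<le>d. (\<Sum>i\<le>d. \<Sum>j\<le>d. a i * b j * of_nat (p i j h)) * A h $ x $ y)" for x y
    proof -
      have "(\<Sum>h\<le>d. (\<Sum>i\<le>d. \<Sum>j\<le>d. a i * b j * of_nat (p i j h)) * A h $ x $ y) =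
        (\<Sum>h\<le>d. \<Sum>i\<le>d. \<Sum>j\<le>d. a i * b j * (of_nat (p i j h) * A h $ x $ y))"
        by (simp add: sum_distrib_right mult.assoc)
      also have "\<dots> = (\<Sum>i\<le>d. \<Sum>j\<le>d. \<Sum>h\<le>d. a i * b j * (of_nat (p i j h) * A h $ x $ y))"
        by (subst sum.swap) (intro sum.cong refl sum.swap)
      finally show ?thesis by (simp add: sum_distrib_left)
    qed
    then show ?thesis by (simp add: vec_eq_iff cscale_mat_def)
  qed
  finally show "F ** G \<in> bose_mesner_algebra d A"
    unfolding bose_mesner_algebra_def mat_span_def by auto
  have "F ** G = (\<Sum>i\<le>d. \<Sum>j\<le>d. (b j * a i) \<odot> (A j ** A i))"
    using scheme_commute[OF assms(1)] by (simp add: F G cscale_mult_sums mult.commute)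
  also have "\<dots> = G ** F"
    by (subst sum.swap) (simp add: F G cscale_mult_sums)
  finally show "F ** G = G ** F" .
qed

lemma bose_mesner_algebra_diff:
  assumes "F \<in> bose_mesner_algebra d A" "G \<in> bose_mesner_algebra d A"
  shows "F - G \<in> bose_mesner_algebra d A"
proof -
  obtain a b where "F = (\<Sum>i\<le>d. a i \<odot> A i)" "G = (\<Sum>i\<le>d. b i \<odot> A i)"
    using assms unfolding bose_mesner_algebra_def mat_span_def by blast
  then have "F - G = (\<Sum>i\<le>d. (a i - b i) \<odot> A i)"
    by (simp add: vec_eq_iff cscale_mat_def sum_subtractf left_diff_distrib)
  then show ?thesis
    unfolding bose_mesner_algebra_def mat_span_def by (auto intro!: exI[of _ "\<lambda>i. a i - b i"])
qed

lemma matrix_diff_distribs: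
  fixes A B C :: "complex ^ 'x ^ 'x::finite"
  shows "A ** (B - C) = A ** B - A ** C" "(B - C) ** A = B ** A - C ** A"
  by (simp_all add: vec_eq_iff matrix_matrix_mult_def sum_subtractf right_diff_distrib left_diff_distrib)

text \<open>Since the algebra is commutative, \<open>E ** F\<close> and \<open>E - E ** F\<close>
  are orthogonal idempotents with sum \<open>E\<close>. Primitivity forces one of them to
  vanish.\<close>

lemma primitive_idempotent_absorb:
  assumes "symmetric_association_scheme d A"
    and E: "primitive_idempotent (bose_mesner_algebra d A) E"
    and F: "F \<in> bose_mesner_algebra d A" "F ** F = F"
    and "E ** F \<noteq> 0"
  shows "E ** F = E"
proof (rule ccontr)
  let ?S = "bose_mesner_algebra d A"
  assume ne: "E ** F \<noteq> E"
  have ES: "E \<in> ?S" and EE: "E ** E = E" using E unfolding primitive_idempotent_def by auto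
  have comm: "F ** E = E ** F" using bose_mesner_algebra_mult(2)[OF assms(1) F(1) ES] .
  have EFS: "E ** F \<in> ?S" using bose_mesner_algebra_mult(1)[OF assms(1) ES F(1)] .
  have l: "E ** (E ** F) = E ** F" by (simp add: matrix_mul_assoc EE)
  have r: "(E ** F) ** E = E ** F" by (metis comm l matrix_mul_assoc)
  have id: "(E ** F) ** (E ** F) = E ** F" by (metis comm l F(2) matrix_mul_assoc)
  have "E - E ** F \<in> ?S" "E - E ** F \<noteq> 0" "(E - E ** F) ** (E - E ** F) = E - E ** F"
    "E ** F ** (E - E ** F) = 0" "(E - E ** F) ** (E ** F) = 0" "E = E ** F + (E - E ** F)"
    using ne by (simp_all add: matrix_diff_distribs bose_mesner_algebra_diff ES EFS EE l r id)
  then show False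
    using E EFS id assms(5) unfolding primitive_idempotent_def by blast
qed

text \<open>If \<open>E i ** E j\<close> were nonzero for distinct indices, absorption on both sides
  would give \<open>E i = E i ** E j = E j\<close>, against linear independence.\<close>

lemma primitive_idempotent_basis_mult:
  assumes sch: "symmetric_association_scheme d A"
    and b: "primitive_idempotent_basis d A E" and i: "i \<le> d" and j: "j \<le> d"
  shows "E i ** E j = (if i = j then E i else 0)"
proof (cases "i = j")
  case True
  then show ?thesis
    using b i unfolding primitive_idempotent_basis_def primitive_idempotent_def by auto
next
  case False
  have pi: "primitive_idempotent (bose_mesner_algebra d A) (E i)" if "i \<le> d" for i
    using b that unfolding primitive_idempotent_basis_def by auto
  have mem: "E i \<in> bose_mesner_algebra d A" "E i ** E i = E i" if "i \<le> d" for i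
    using pi[OF that] unfolding primitive_idempotent_def by auto
  have "E i ** E j = 0"
  proof (rule ccontr)
    assume ne: "E i ** E j \<noteq> 0"
    have c: "E j ** E i = E i ** E j"
      using bose_mesner_algebra_mult(2)[OF sch mem(1)[OF j] mem(1)[OF i]] .
    have "E i ** E j = E i"
      using primitive_idempotent_absorb[OF sch pi[OF i] mem[OF j] ne] .
    moreover have "E j ** E i = E j"
      using primitive_idempotent_absorb[OF sch pi[OF j] mem[OF i]] ne c by simp
    ultimately have eq: "E i = E j" using c by simp
    \<comment> \<open>The coefficients of the nontrivial relation
      \<open>E i - E j = 0\<close>.\<close>
    define c :: "nat \<Rightarrow> complex" where "c = (\<lambda>h. of_bool (h = i) - of_bool (h = j))"
    have "(\<Sum>h\<le>d. c h \<odot> E h) = 0"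
      using i j eq by (simp add: c_def vec_eq_iff cscale_mat_def sum_subtractf left_diff_distrib
          of_bool_def if_distrib[of "\<lambda>u. u * _"] cong: if_cong)
    then have "c i = 0"
      using b i unfolding primitive_idempotent_basis_def mat_independent_def by blast
    then show False using False by (simp add: c_def)
  qed
  then show ?thesis using False by simp
qed

section \<open>From association schemes to colourings with known eigenvalues\<close>

text \<open>\<open>col x y\<close> is the index of the relation containing \<open>(x, y)\<close>. A real element \<open>\<Sum>j. a j A\<^sub>j\<close> of
  the algebra has entries \<open>a (col x y)\<close>, and its eigenvalues are \<open>\<Sum>j. a j P\<^sub>i\<^sub>j\<close>.\<close>

locale eigen_colouring =
  fixes d :: nat and col :: "'x::finite \<Rightarrow> 'x \<Rightarrow> nat" and P :: "nat \<Rightarrow> nat \<Rightarrow> real"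
  assumes col_le: "col x y \<le> d"
    and col_sym: "col x y = col y x"
    and col_eq_0_iff: "col x y = 0 \<longleftrightarrow> x = y"
    and col_mult: "(\<And>i. i \<le> d \<Longrightarrow> (\<Sum>j\<le>d. a j * P i j) * (\<Sum>j\<le>d. b j * P i j) = (\<Sum>j\<le>d. c j * P i j))
      \<Longrightarrow> (\<Sum>y\<in>UNIV. a (col x y) * b (col y z)) = c (col x z)"

text \<open>The A_i are 0-1 matrices with sum J, so each pair of vertices lies in exactly one
  relation. In the basis of idempotents the coefficient of E_i in a combination of the A_j is an
  eigenvalue read off from row i of P, and by orthogonality these coefficients multiply.\<close>

lemma eigen_colouring_exists:
  fixes A E :: "nat \<Rightarrow> complex ^ 'x ^ 'x::finite"
  assumes sch: "symmetric_association_scheme d A"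
    and b: "primitive_idempotent_basis d A E"
    and P: "first_eigenmatrix d A E (\<lambda>i j. complex_of_real (P i j))"
  obtains col :: "'x \<Rightarrow> 'x \<Rightarrow> nat" where "eigen_colouring d col P"
proof -
  have A01: "A i $ x $ y \<in> {0, 1}" if "i \<le> d" for i x y
    using sch that unfolding symmetric_association_scheme_def by blast
  have A0: "A 0 = mat 1" and AJ: "(\<Sum>i\<le>d. A i) = all_ones"
    and sym: "\<And>i. i \<le> d \<Longrightarrow> transpose (A i) = A i"
    using sch unfolding symmetric_association_scheme_def by auto
  have ent: "A h $ y $ x = A h $ x $ y" if "h \<le> d" for h x y
    using arg_cong[OF sym[OF that], of "\<lambda>M. M $ x $ y"] by (simp add: transpose_def)
  have one: "\<exists>!i. i \<le> d \<and> A i $ x $ y = 1" for x y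
  proof -
    have row: "(\<Sum>i\<le>d. A i $ x $ y) = 1"
      using arg_cong[OF AJ, of "\<lambda>M. M $ x $ y"] by (simp add: all_ones_def)
    have "(\<Sum>i\<le>d. A i $ x $ y) = (\<Sum>i\<le>d. if A i $ x $ y = 1 then 1 else 0)"
      by (rule sum.cong) (use A01 in fastforce)+
    also have "\<dots> = of_nat (card {i. i \<le> d \<and> A i $ x $ y = 1})"
      by (simp add: sum.If_cases Int_def)
    finally have "card {i. i \<le> d \<and> A i $ x $ y = 1} = 1"
      unfolding row of_nat_1_eq_iff by simp
    then obtain i where "{i. i \<le> d \<and> A i $ x $ y = 1} = {i}" by (auto simp: card_1_singleton_iff)
    then show ?thesis by (metis (mono_tags, lifting) mem_Collect_eq singletonD singletonI)
  qed
  define col where "col = (\<lambda>x y. THE i. i \<le> d \<and> A i $ x $ y = 1)"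
  have colp: "col x y \<le> d" "A (col x y) $ x $ y = 1" for x y
    using theI'[OF one[of x y]] by (auto simp: col_def)
  have Acol: "A i $ x $ y = (if col x y = i then 1 else 0)" if "i \<le> d" for i x y
    using colp[of x y] A01[OF that, of x y] one[of x y] that by auto
  have comb: "(\<Sum>i\<le>d. f i \<odot> A i) $ x $ y = f (col x y)" for f x y
  proof -
    have "(\<Sum>i\<le>d. f i \<odot> A i) $ x $ y = (\<Sum>i\<le>d. f i * A i $ x $ y)"
      by (simp add: cscale_mat_def)
    also have "\<dots> = (\<Sum>i\<le>d. if col x y = i then f i else 0)"
      by (rule sum.cong) (simp_all add: Acol)
    finally show ?thesis using colp(1) by simp
  qed
  have AE: "(\<Sum>j\<le>d. complex_of_real (a j) \<odot> A j) = (\<Sum>i\<le>d. complex_of_real (\<Sum>j\<le>d. a j * P i j) \<odot> E i)" for a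
  proof -
    have Aj: "A j $ x $ y = (\<Sum>i\<le>d. complex_of_real (P i j) * E i $ x $ y)" if "j \<le> d" for j x y
      using P that unfolding first_eigenmatrix_def by (simp add: cscale_mat_def)
    have "(\<Sum>j\<le>d. complex_of_real (a j) * A j $ x $ y) =
       (\<Sum>i\<le>d. (\<Sum>j\<le>d. complex_of_real (a j) * complex_of_real (P i j)) * E i $ x $ y)" for x y
    proof -
      have "(\<Sum>j\<le>d. complex_of_real (a j) * A j $ x $ y) =
        (\<Sum>j\<le>d. \<Sum>i\<le>d. complex_of_real (a j) * complex_of_real (P i j) * E i $ x $ y)"
        by (intro sum.cong refl) (simp add: Aj sum_distrib_left mult.assoc)
      also have "\<dots> = (\<Sum>i\<le>d. \<Sum>j\<le>d. complex_of_real (a j) * complex_of_real (P i j) * E i $ x $ y)"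
        by (rule sum.swap)
      finally show ?thesis by (simp add: sum_distrib_right)
    qed
    then show ?thesis by (simp add: vec_eq_iff cscale_mat_def)
  qed
  have "eigen_colouring d col P"
  proof
    show "col x y \<le> d" for x y by (rule colp)
    show "col x y = col y x" for x y
      using Acol[OF colp(1)[of y x], of x y] colp(2)[of y x] ent[OF colp(1)[of y x], of x y]
      by (auto split: if_splits)
    show "col x y = 0 \<longleftrightarrow> x = y" for x y
      using Acol[of 0 x y] by (auto simp: A0 mat_def split: if_splits)
  next
    fix a b' c x z
    assume h: "\<And>i. i \<le> d \<Longrightarrow> (\<Sum>j\<le>d. a j * P i j) * (\<Sum>j\<le>d. b' j * P i j) = (\<Sum>j\<le>d. c j * P i j)"
    define la where "la = (\<lambda>i. \<Sum>j\<le>d. a j * P i j)"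
    define lb where "lb = (\<lambda>i. \<Sum>j\<le>d. b' j * P i j)"
    have z: "w \<odot> (0 :: complex ^ 'x ^ 'x) = 0" for w by (simp add: cscale_mat_def vec_eq_iff)
    have "(\<Sum>j\<le>d. complex_of_real (a j) \<odot> A j) ** (\<Sum>j\<le>d. complex_of_real (b' j) \<odot> A j) =
      (\<Sum>i\<le>d. complex_of_real (la i) \<odot> E i) ** (\<Sum>i\<le>d. complex_of_real (lb i) \<odot> E i)"
      by (simp only: AE la_def lb_def)
    also have "\<dots> = (\<Sum>i\<le>d. \<Sum>j\<le>d. if i = j then (complex_of_real (la i) * complex_of_real (lb i)) \<odot> E i else 0)"
      unfolding cscale_mult_sums
      by (intro sum.cong refl) (auto simp: primitive_idempotent_basis_mult[OF sch b] z)
    also have "\<dots> = (\<Sum>i\<le>d. complex_of_real (la i * lb i) \<odot> E i)"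
      by simp
    also have "\<dots> = (\<Sum>i\<le>d. complex_of_real (\<Sum>j\<le>d. c j * P i j) \<odot> E i)"
      by (intro sum.cong refl) (simp only: la_def lb_def h atMost_iff)
    also have "\<dots> = (\<Sum>j\<le>d. complex_of_real (c j) \<odot> A j)" by (simp only: AE)
    finally have "((\<Sum>j\<le>d. complex_of_real (a j) \<odot> A j) ** (\<Sum>j\<le>d. complex_of_real (b' j) \<odot> A j)) $ x $ z =
      (\<Sum>j\<le>d. complex_of_real (c j) \<odot> A j) $ x $ z" by simp
    then have "(\<Sum>y\<in>UNIV. complex_of_real (a (col x y)) * complex_of_real (b' (col y z))) = complex_of_real (c (col x z))"
      by (simp only: matrix_matrix_mult_def vec_lambda_beta comb)
    then have "complex_of_real (\<Sum>y\<in>UNIV. a (col x y) * b' (col y z)) = complex_of_real (c (col x z))"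
      by simp
    then show "(\<Sum>y\<in>UNIV. a (col x y) * b' (col y z)) = c (col x z)"
      by (simp only: of_real_eq_iff)
  qed
  then show ?thesis by (rule that)
qed

section \<open>Equivalence relations with classes of equal size\<close>

text \<open>The classes inside \<open>S\<close> partition it into sets of size \<open>c\<close>, so
  there are \<open>CARD('i)\<close> of them. A bijection from the index type to the classes,
  followed by a choice in each class, gives \<open>r\<close>.\<close>

lemma transversal_exists:
  fixes R :: "'x::finite \<Rightarrow> 'x \<Rightarrow> bool"
  assumes R: "equivp R" and cl: "\<And>x. x \<in> S \<Longrightarrow> card {y \<in> S. R x y} = c"
    and S: "card S = c * CARD('i::finite)" and c: "c > 0"
  obtains r :: "'i::finite \<Rightarrow> 'x" where "\<And>i. r i \<in> S" "\<And>i j. R (r i) (r j) \<longleftrightarrow> i = j"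
proof -
  define Q where "Q = (\<lambda>x. {y \<in> S. R x y}) ` S"
  have eqv: "R x x" "R x y \<Longrightarrow> R y x" "R x y \<Longrightarrow> R y z \<Longrightarrow> R x z" for x y z
    using equivp_reflp[OF R] equivp_symp[OF R] equivp_transp[OF R] by blast+
  have "c * card Q = card (\<Union>Q)"
  proof (rule card_partition)
    show "card q = c" if "q \<in> Q" for q using that cl by (auto simp: Q_def)
    show "q \<inter> q' = {}" if qq: "q \<in> Q" "q' \<in> Q" "q \<noteq> q'" for q q'
    proof -
      obtain x x' where q: "q = {y \<in> S. R x y}" "q' = {y \<in> S. R x' y}" using qq(1,2) unfolding Q_def by blast
      show ?thesis
      proof (rule ccontr)
        assume "q \<inter> q' \<noteq> {}"
        then have "R x x'" unfolding q using eqv(2,3) by blast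
        then have "R x y = R x' y" for y using eqv(2,3) by blast
        then show False using qq(3) by (simp add: q)
      qed
    qed
  qed auto
  also have "\<Union>Q = S" using eqv(1) by (auto simp: Q_def)
  finally have "card Q = CARD('i)" using S c by simp
  then obtain g where g: "bij_betw g (UNIV :: 'i set) Q"
    using finite_same_card_bij[of "UNIV :: 'i set" Q] by auto
  have "\<exists>x. x \<in> S \<and> g i = {y \<in> S. R x y}" for i
    using bij_betw_apply[OF g, of i] by (auto simp: Q_def)
  then obtain r where r: "\<And>i. r i \<in> S" "\<And>i. g i = {y \<in> S. R (r i) y}" by metis
  have "R (r i) (r j) \<longleftrightarrow> i = j" for i j
  proof
    assume "R (r i) (r j)"
    then have "R (r i) y = R (r j) y" for y using eqv(2,3) by blast
    then have "g i = g j" by (simp add: r(2))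
    then show "i = j" using g by (metis UNIV_I bij_betw_def inj_on_def)
  qed (simp add: eqv(1))
  then show ?thesis using r(1) that by blast
qed

context eigen_colouring
begin

definition rel :: "nat set \<Rightarrow> 'x \<Rightarrow> 'x \<Rightarrow> bool" where
  "rel K x y \<longleftrightarrow> col x y \<in> K"

lemma rel_sym: "rel K x y \<longleftrightarrow> rel K y x"
  by (simp add: rel_def col_sym[of x])

text \<open>The sum counts the \<open>y\<close> related to both \<open>x\<close> and
  \<open>z\<close>. It vanishes when \<open>x\<close> and \<open>z\<close> are unrelated, which is
  transitivity; for \<open>x = z\<close> it is the size of the class.\<close>

lemma rel_equivp:
  assumes "0 \<in> K"
    and sq: "\<And>x z. (\<Sum>y\<in>UNIV. of_bool (col x y \<in> K) * of_bool (col y z \<in> K)) = real c * of_bool (col x z \<in> K)"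
  shows "equivp (rel K)" "card {y. rel K x y} = c"
proof -
  show "equivp (rel K)"
  proof (intro equivpI reflpI sympI transpI)
    show "rel K x x" for x using assms(1) col_eq_0_iff[of x x] by (simp add: rel_def)
    show "rel K x y \<Longrightarrow> rel K y x" for x y by (simp add: rel_sym)
    show "rel K x z" if "rel K x y" "rel K y z" for x y z
    proof (rule ccontr)
      assume "\<not> rel K x z"
      then have "(\<Sum>y\<in>UNIV. of_bool (col x y \<in> K) * of_bool (col y z \<in> K) :: real) = 0"
        using sq[of x z] by (simp add: rel_def)
      then have "of_bool (col x y \<in> K) * of_bool (col y z \<in> K) = (0::real)"
        by (subst (asm) sum_nonneg_eq_0_iff) auto
      then show False using that by (simp add: rel_def)
    qed
  qed
  have "col x x \<in> K" using assms(1) col_eq_0_iff[of x x] by simp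
  have "real (card {y. rel K x y}) = (\<Sum>y\<in>UNIV. of_bool (col x y \<in> K) * of_bool (col y x \<in> K))"
    by (simp add: rel_def col_sym[of _ x] flip: of_bool_conj)
  also have "\<dots> = real c" using sq[of x x] \<open>col x x \<in> K\<close> by simp
  finally show "card {y. rel K x y} = c" by simp
qed

end

section \<open>Eigenvalue calculus for the given matrix P\<close>

locale weighing_scheme =
  eigen_colouring 7 col "\<lambda>i j. P_rows (real m) (real n) (real k) ! i ! j"
  for col :: "'x::finite \<Rightarrow> 'x \<Rightarrow> nat" and m n k :: nat +
  assumes m2: "m \<ge> 2" and n2: "n \<ge> 2" and k1: "k \<ge> 1"
begin

text \<open>The eigenvalue of A_4 on E_7, the local \<open>t\<close> of
  \<open>P_rows\<close>.\<close>

definition t :: real where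
  "t = sqrt (real k * (real m * real n - real n - real k)) / sqrt ((real m - 1) * (real n - 1))"

text \<open>Writing m as \<open>mu + 1\<close> turns the denominators m - 1 into a single positive
  variable.\<close>

definition mu :: real where
  "mu = real m - 1"

text \<open>P applied to the coefficient vector \<open>a\<close>: the eigenvalues of the combination
  of the A_j on E_0, ..., E_7. Here \<open>D\<close> is half the valency of A_6.\<close>

definition eigenvalues :: "(nat \<Rightarrow> real) \<Rightarrow> real list" where
  "eigenvalues a = (let N = real n; K = real k; D = mu * N - K in
    [a 0 + a 1 + 2 * (N - 1) * a 2 + 2 * mu * N * a 3 + K * (a 4 + a 5) + 2 * D * a 6 + 2 * N * a 7,
     a 0 - a 1 + sqrt K * (a 4 - a 5),
     a 0 + a 1 + 2 * (N - 1) * a 2 - 2 * N * a 3 - K / mu * (a 4 + a 5) - 2 * D / mu * a 6 + 2 * N * a 7,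
     a 0 + a 1 + 2 * (N - 1) * a 2 - 2 * N * a 3 + K / mu * (a 4 + a 5) + 2 * D / mu * a 6 - 2 * N * a 7,
     a 0 - a 1 - sqrt K * (a 4 - a 5),
     a 0 + a 1 + 2 * (N - 1) * a 2 + 2 * mu * N * a 3 - K * (a 4 + a 5) - 2 * D * a 6 - 2 * N * a 7,
     a 0 + a 1 - 2 * a 2 - t * (a 4 + a 5 - 2 * a 6),
     a 0 + a 1 - 2 * a 2 + t * (a 4 + a 5 - 2 * a 6)])"

lemma param_pos: "mu > 0" "real n > 1" "real k > 0" and real_m: "real m = mu + 1"
  using m2 n2 k1 by (simp_all add: mu_def)

lemma eigenvalues_nth:
  assumes "i \<le> 7"
  shows "(\<Sum>j\<le>7. a j * P_rows (real m) (real n) (real k) ! i ! j) = eigenvalues a ! i"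
proof -
  have s: "(\<Sum>j\<le>7. f j) = f 0 + f 1 + f 2 + f 3 + f 4 + f 5 + f 6 + f 7" for f :: "nat \<Rightarrow> real"
    by (simp add: eval_nat_numeral)
  consider "i = 0" | "i = 1" | "i = 2" | "i = 3" | "i = 4" | "i = 5" | "i = 6" | "i = 7"
    using assms by linarith
  then show ?thesis
    unfolding P_rows_def eigenvalues_def Let_def t_def[symmetric] s unfolding real_m
    by cases (simp_all add: divide_inverse algebra_simps)
qed

text \<open>The form in which \<open>col_mult\<close> is used below: an identity between products in
  the algebra is verified by eight scalar identities.\<close>

lemma mult:
  assumes "map2 (*) (eigenvalues a) (eigenvalues b) = eigenvalues c"
  shows "(\<Sum>y\<in>UNIV. a (col x y) * b (col y z)) = c (col x z)"
proof (rule col_mult)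
  fix i :: nat assume i: "i \<le> 7"
  have "length (eigenvalues f) = 8" for f by (simp add: eigenvalues_def Let_def)
  then have "eigenvalues a ! i * eigenvalues b ! i = eigenvalues c ! i"
    using i by (simp flip: assms)
  then show "(\<Sum>j\<le>7. a j * P_rows (real m) (real n) (real k) ! i ! j) *
      (\<Sum>j\<le>7. b j * P_rows (real m) (real n) (real k) ! i ! j) =
      (\<Sum>j\<le>7. c j * P_rows (real m) (real n) (real k) ! i ! j)"
    using i by (simp add: eigenvalues_nth)
qed

text \<open>The second assumption says that every eigenvalue of the union of the relations in
  \<open>K\<close> is 0 or \<open>c\<close>.\<close>

lemma rel_class:
  assumes "0 \<in> K"
    and "map2 (*) (eigenvalues (\<lambda>j. of_bool (j \<in> K))) (eigenvalues (\<lambda>j. of_bool (j \<in> K))) =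
      eigenvalues (\<lambda>j. real c * of_bool (j \<in> K))"
  shows "equivp (rel K)" "card {y. rel K x y} = c"
  using rel_equivp[OF assms(1) mult[OF assms(2)]] by blast+

text \<open>The classes of \<open>K1\<close> are the antipodal pairs, those of \<open>K3\<close> the halves and those of \<open>K2\<close> the
  groups within a half; a class of \<open>K7\<close> consists of two matched groups from different halves.\<close>

abbreviation "K1 \<equiv> {0, Suc 0}"
abbreviation "K2 \<equiv> {0, Suc 0, 2}"
abbreviation "K3 \<equiv> {0, Suc 0, 2, 3}"
abbreviation "K7 \<equiv> {0, Suc 0, 2, 7}"

lemma K1: "equivp (rel K1)" "card {y. rel K1 x y} = 2"
  by (rule rel_class, simp, simp add: eigenvalues_def Let_def)+

lemma K2: "equivp (rel K2)" "card {y. rel K2 x y} = 2 * n"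
  by (rule rel_class[where c = "2 * n"], simp, simp add: eigenvalues_def Let_def algebra_simps)+

lemma K3: "equivp (rel K3)" "card {y. rel K3 x y} = 2 * m * n"
  by (rule rel_class[where c = "2 * m * n"], simp, simp add: eigenvalues_def real_m Let_def algebra_simps)+

lemma K7: "equivp (rel K7)" "card {y. rel K7 x y} = 4 * n"
  by (rule rel_class[where c = "4 * n"], simp, simp add: eigenvalues_def Let_def algebra_simps)+

text \<open>All vertices form the single class of the union of all relations, whose size is the sum
  of the valencies in the first row of P.\<close>

lemma card_UNIV: "CARD('x) = 4 * m * n"
proof -
  have "map2 (*) (eigenvalues (\<lambda>j. of_bool (j \<in> {..7}))) (eigenvalues (\<lambda>j. of_bool (j \<in> {..7}))) =
      eigenvalues (\<lambda>j. real (4 * m * n) * of_bool (j \<in> {..7}))"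
    using param_pos by (simp add: eigenvalues_def real_m Let_def field_simps)
  then have "card {y. rel {..7} x y} = 4 * m * n" for x
    by (intro rel_class) simp_all
  moreover have "{y. rel {..7} x y} = UNIV" for x using col_le by (auto simp: rel_def)
  ultimately show ?thesis by simp
qed

text \<open>Twice this number is the valency of A_6, a row sum of a 0-1 matrix. It makes the
  radicand in \<open>t\<close> non-negative.\<close>

lemma mu_n_k: "mu * real n - real k \<ge> 0"
proof -
  fix x :: 'x
  have "(\<Sum>y\<in>UNIV. of_bool (col x y = 6) * 1) = 2 * (mu * real n - real k)"
    by (rule mult[where a = "\<lambda>j. of_bool (j = 6)" and b = "\<lambda>j. 1"
          and c = "\<lambda>j. 2 * (mu * real n - real k)"])
      (use param_pos in \<open>simp add: eigenvalues_def Let_def field_simps\<close>)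
  moreover have "(\<Sum>y\<in>UNIV. of_bool (col x y = 6) * 1) \<ge> (0::real)" by (intro sum_nonneg) auto
  ultimately show ?thesis by simp
qed

lemma t_square: "t * t = real k * (mu * real n - real k) / (mu * (real n - 1))"
proof -
  have "t = sqrt (real k * (mu * real n - real k)) / sqrt (mu * (real n - 1))"
    by (simp add: t_def mu_def algebra_simps)
  then show ?thesis using mu_n_k param_pos by simp
qed

section \<open>Identities for A_4 - A_5 and A_4 + A_5\<close>

text \<open>Coefficients of A_4 - A_5, from which \<open>W\<close> is cut out, and of A_4 + A_5,
  from which its absolute value is.\<close>

abbreviation f4 :: "nat \<Rightarrow> real" where "f4 j \<equiv> of_bool (j = 4) - of_bool (j = 5)"
abbreviation f5 :: "nat \<Rightarrow> real" where "f5 j \<equiv> of_bool (j \<in> {4, 5})"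

text \<open>Twice these numbers are the coefficients of \<open>A\<^sub>2\<close> and \<open>A\<^sub>3\<close> in \<open>(A\<^sub>4 + A\<^sub>5)\<^sup>2\<close>, obtained by
  solving for its eigenvalues.\<close>

definition alpha :: real where
  "alpha = real k * (real k - mu) / (mu * (real n - 1))"
definition beta :: real where
  "beta = real k ^ 2 * (mu - 1) / (real n * mu ^ 2)"

text \<open>A_1 is symmetric with square I, so each of its rows contains a single 1: every vertex
  has one antipode.\<close>

lemma mate_unique:
  assumes "col x y = 1" "col x z = 1"
  shows "y = z"
proof -
  have "(\<Sum>y\<in>UNIV. of_bool (col x y = 1) * of_bool (col y x = 1)) = (of_bool (col x x = 0) :: real)"
    by (rule mult[where a = "\<lambda>j. of_bool (j = 1)" and b = "\<lambda>j. of_bool (j = 1)" and c = "\<lambda>j. of_bool (j = 0)"])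
      (simp add: eigenvalues_def Let_def)
  moreover have "of_bool (col x y = 1) * of_bool (col y x = 1) = (of_bool (col x y = 1) :: real)" for y
    by (simp add: col_sym[of y x])
  ultimately have "(\<Sum>y\<in>UNIV. of_bool (col x y = 1)) = (1 :: real)"
    using col_eq_0_iff[of x x] by (simp only:) simp
  then have "card {y. col x y = 1} = 1" by simp
  then obtain w where "{y. col x y = 1} = {w}" by (auto simp: card_1_singleton_iff)
  then show ?thesis using assms by (metis mem_Collect_eq singletonD)
qed

lemma mate_sum:
  assumes "col x y = 1"
  shows "(\<Sum>w\<in>UNIV. of_bool (col x w = 1) * g w) = (g y :: real)"
proof -
  have "(\<Sum>w\<in>UNIV. of_bool (col x w = 1) * g w) = (\<Sum>w\<in>UNIV. if w = y then g w else 0)"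
    by (rule sum.cong) (use assms mate_unique in auto)
  then show ?thesis by simp
qed

text \<open>A_4 - A_5 has nonzero eigenvalues only on E_1 and E_4, where A_1 acts as -1.\<close>

lemma f4_mate:
  assumes "col x y = 1"
  shows "f4 (col y z) = - f4 (col x z)"
proof -
  have "(\<Sum>w\<in>UNIV. of_bool (col x w = 1) * f4 (col w z)) = - f4 (col x z)"
    by (rule mult[where a = "\<lambda>j. of_bool (j = 1)" and b = f4 and c = "\<lambda>j. - f4 j"])
      (simp add: eigenvalues_def Let_def)
  then show ?thesis by (simp only: mate_sum[OF assms])
qed

text \<open>A_4 + A_5 vanishes on E_1 and E_4, and A_1 acts as 1 on all other E_i.\<close>

lemma f5_mate:
  assumes "col x y = 1"
  shows "f5 (col y z) = f5 (col x z)"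
proof -
  have "(\<Sum>w\<in>UNIV. of_bool (col x w = 1) * f5 (col w z)) = f5 (col x z)"
    by (rule mult[where a = "\<lambda>j. of_bool (j = 1)" and b = f5 and c = f5])
      (simp add: eigenvalues_def Let_def)
  then show ?thesis by (simp only: mate_sum[OF assms])
qed

text \<open>Both sides have eigenvalue 4k on E_1 and E_4 and 0 elsewhere. Half of this identity is
  the weighing equation.\<close>

lemma f4_square:
  "(\<Sum>y\<in>UNIV. f4 (col x y) * f4 (col y z)) = 2 * real k * (of_bool (col x z = 0) - of_bool (col x z = 1))"
  by (rule mult[where a = f4 and b = f4 and c = "\<lambda>j. 2 * real k * (of_bool (j = 0) - of_bool (j = 1))"])
    (simp add: eigenvalues_def Let_def)

lemma f5_square:
  "(\<Sum>y\<in>UNIV. f5 (col x y) * f5 (col y z)) =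
    2 * (real k * of_bool (col x z \<in> K1) + alpha * of_bool (col x z = 2) + beta * of_bool (col x z = 3))"
proof (rule mult[where a = f5 and b = f5
      and c = "\<lambda>j. 2 * (real k * of_bool (j \<in> K1) + alpha * of_bool (j = 2) + beta * of_bool (j = 3))"])
  \<comment> \<open>With \<open>n = N + 1\<close> the denominator n - 1 becomes a positive
    variable.\<close>
  define N where "N = real n - 1"
  have n: "real n = N + 1" and N: "N > 0" using param_pos by (simp_all add: N_def)
  note p = param_pos N
  note ab = alpha_def beta_def t_square n
  \<comment> \<open>The squared eigenvalues of A_4 + A_5 in turn on E_0 and E_5, on E_2 and E_3, and
    on E_6 and E_7. On E_1 and E_4 both sides are 0.\<close>
  have "4 * (real k)\<^sup>2 = 4 * real k + 4 * N * alpha + 4 * mu * (N + 1) * beta"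
    unfolding ab using p by (simp add: divide_simps) algebra
  moreover have "4 * (real k)\<^sup>2 / mu\<^sup>2 = 4 * real k + 4 * N * alpha - 4 * (N + 1) * beta"
    unfolding ab using p by (simp add: divide_simps) algebra
  moreover have "4 * (t * t) = 4 * real k - 4 * alpha"
    unfolding ab using p by (simp add: divide_simps) algebra
  ultimately show "map2 (*) (eigenvalues f5) (eigenvalues f5) = eigenvalues
     (\<lambda>j. 2 * (real k * of_bool (j \<in> K1) + alpha * of_bool (j = 2) + beta * of_bool (j = 3)))"
    unfolding eigenvalues_def Let_def n
    by (simp add: algebra_simps power2_eq_square)
qed

text \<open>Source of the product of the absolute value of \<open>W\<close> with
  \<open>block_J\<close>: colours 4, 5 and 6 are those between unmatched groups of different
  halves.\<close>

lemma f5_K2: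
  "(\<Sum>y\<in>UNIV. f5 (col x y) * of_bool (col y z \<in> K2)) =
    2 * (real k / mu) * of_bool (col x z \<in> {4, 5, 6})"
  by (rule mult[where a = f5 and b = "\<lambda>j. of_bool (j \<in> K2)"
        and c = "\<lambda>j. 2 * (real k / mu) * of_bool (j \<in> {4, 5, 6})"])
    (use param_pos in \<open>simp add: eigenvalues_def Let_def field_simps\<close>)

lemma f4_sym_mate: "col y y' = 1 \<Longrightarrow> f4 (col x y') = - f4 (col x y)"
  using f4_mate[of y y' x] by (simp only: col_sym[of x])

lemma f5_sym_mate: "col y y' = 1 \<Longrightarrow> f5 (col x y') = f5 (col x y)"
  using f5_mate[of y y' x] by (simp only: col_sym[of x])

lemma K2_mate:
  assumes "col y y' = 1"
  shows "rel K2 y' z = rel K2 y z"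
proof -
  have "rel K2 y y'" using assms by (simp add: rel_def)
  then show ?thesis
    using equivp_symp[OF K2(1)] equivp_transp[OF K2(1)] by blast
qed

section \<open>Halves, groups and labellings by representatives of antipodal pairs\<close>

lemma same_half_block: "rel K3 x y \<Longrightarrow> rel K7 x y \<longleftrightarrow> rel K2 x y"
  by (auto simp: rel_def)

text \<open>Three different halves would contain 6mn of the 4mn vertices.\<close>

lemma only_two_halves:
  assumes xy: "\<not> rel K3 x y" and yz: "\<not> rel K3 y z"
  shows "rel K3 x z"
proof (rule ccontr)
  assume xz: "\<not> rel K3 x z"
  let ?H = "\<lambda>u. {w. rel K3 u w}"
  have disj: "?H u \<inter> ?H v = {}" if "\<not> rel K3 u v" for u v
    using that equivp_symp[OF K3(1)] equivp_transp[OF K3(1)] by blast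
  have "card (?H x \<union> ?H y \<union> ?H z) = card (?H x) + card (?H y) + card (?H z)"
    using disj[OF xy] disj[OF yz] disj[OF xz] by (simp add: card_Un_disjoint Int_Un_distrib2)
  also have "\<dots> = 6 * (m * n)" by (simp add: K3(2))
  finally have eq: "card (?H x \<union> ?H y \<union> ?H z) = 6 * (m * n)" .
  have "card (?H x \<union> ?H y \<union> ?H z) \<le> CARD('x)" by (intro card_mono) simp_all
  then have "6 * (m * n) \<le> CARD('x)" unfolding eq .
  then have "m * n = 0" by (auto simp: card_UNIV)
  then show False using m2 n2 by simp
qed

text \<open>A class of \<open>K7\<close> meets the half of its member \<open>x\<close> in the
  \<open>K2\<close> class of \<open>x\<close>, with 2n vertices. The other 2n of its 4n vertices lie
  in the other half.\<close>

lemma half_block_card: "card {w. rel K3 h w \<and> rel K7 x w} = 2 * n"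
proof (cases "rel K3 h x")
  case True
  have "{w. rel K3 h w \<and> rel K7 x w} = {w. rel K2 x w}"
  proof (intro Collect_cong iffI)
    show "rel K2 x w" if "rel K3 h w \<and> rel K7 x w" for w
      using that True same_half_block equivp_symp[OF K3(1)] equivp_transp[OF K3(1)] by metis
    show "rel K3 h w \<and> rel K7 x w" if "rel K2 x w" for w
    proof -
      have "rel K3 x w" "rel K7 x w" using that by (auto simp: rel_def)
      then show ?thesis using True equivp_transp[OF K3(1)] by metis
    qed
  qed
  then show ?thesis by (simp add: K2(2))
next
  case False
  have "rel K3 h w \<longleftrightarrow> \<not> rel K3 x w" for w
    using False only_two_halves equivp_symp[OF K3(1)] equivp_transp[OF K3(1)] by metis
  then have "{w. rel K3 h w \<and> rel K7 x w} = {w. rel K7 x w} - {w. rel K2 x w}"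
    using same_half_block by (auto simp: rel_def)
  moreover have "{w. rel K2 x w} \<subseteq> {w. rel K7 x w}" by (auto simp: rel_def)
  ultimately show ?thesis by (simp add: card_Diff_subset K2(2) K7(2))
qed

text \<open>\<open>s\<close> picks one vertex from each antipodal pair in the half containing \<open>h\<close>. The first label
  is that of the class of \<open>K7\<close> represented by \<open>g\<close>; these classes meet both halves, so using the same
  \<open>g\<close> for both halves aligns their labels.\<close>

definition labelling :: "('m \<Rightarrow> 'x) \<Rightarrow> 'x \<Rightarrow> ('m \<times> 'n \<Rightarrow> 'x) \<Rightarrow> bool" where
  "labelling g h s \<longleftrightarrow> (\<forall>p. rel K3 h (s p) \<and> rel K7 (g (fst p)) (s p)) \<and>
     (\<forall>p q. rel K1 (s p) (s q) \<longleftrightarrow> p = q)"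

text \<open>Each class of \<open>K7\<close> meets the half in 2n vertices, that is, in n antipodal
  pairs; one vertex is chosen from each. Choices for different first labels are not antipodal
  because \<open>K1\<close> refines \<open>K7\<close>.\<close>

lemma labelling_exists:
  fixes g :: "'m \<Rightarrow> 'x"
  assumes g: "\<And>i j. rel K7 (g i) (g j) \<longleftrightarrow> i = j" and n: "CARD('n::finite) = n"
  obtains s :: "'m \<times> 'n::finite \<Rightarrow> 'x" where "labelling g h s"
proof -
  have "\<exists>r :: 'n \<Rightarrow> 'x. (\<forall>j. rel K3 h (r j) \<and> rel K7 (g i) (r j)) \<and> (\<forall>j j'. rel K1 (r j) (r j') \<longleftrightarrow> j = j')" for i
  proof -
    let ?S = "{w. rel K3 h w \<and> rel K7 (g i) w}"
    have "card {y \<in> ?S. rel K1 x y} = 2" if "x \<in> ?S" for x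
    proof -
      \<comment> \<open>\<open>?S\<close> is closed under antipodes, so antipodal classes counted
        inside it keep their size 2.\<close>
      have "y \<in> ?S" if "rel K1 x y" for y
      proof -
        have "rel K3 x y" "rel K7 x y" using that by (auto simp: rel_def)
        then show ?thesis
          using \<open>x \<in> ?S\<close> equivp_transp[OF K3(1), of h x y] equivp_transp[OF K7(1), of "g i" x y] by simp
      qed
      then have "{y \<in> ?S. rel K1 x y} = {y. rel K1 x y}" by auto
      then show ?thesis by (simp add: K1(2))
    qed
    moreover have "card ?S = 2 * CARD('n)" by (simp add: half_block_card n)
    ultimately obtain r :: "'n \<Rightarrow> 'x" where "\<And>j. r j \<in> ?S" "\<And>j j'. rel K1 (r j) (r j') \<longleftrightarrow> j = j'"
      by (rule transversal_exists[OF K1(1), of ?S 2]) auto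
    then show ?thesis by blast
  qed
  then obtain r :: "'m \<Rightarrow> 'n \<Rightarrow> 'x" where r: "\<And>i j. rel K3 h (r i j)" "\<And>i j. rel K7 (g i) (r i j)"
    "\<And>i j j'. rel K1 (r i j) (r i j') \<longleftrightarrow> j = j'"
    by metis
  have "rel K1 (r i j) (r i' j') \<longleftrightarrow> i = i' \<and> j = j'" for i j i' j'
  proof
    assume a: "rel K1 (r i j) (r i' j')"
    then have "rel K7 (r i j) (r i' j')" by (auto simp: rel_def)
    then have "rel K7 (g i) (g i')"
      using r(2) equivp_symp[OF K7(1)] equivp_transp[OF K7(1)] by metis
    then have "i = i'" using g by simp
    then show "i = i' \<and> j = j'" using a r(3) by blast
  qed (use r(3) in blast)
  then have "labelling g h (\<lambda>p. r (fst p) (snd p))"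
    using r(1,2) by (simp add: labelling_def prod_eq_iff)
  then show ?thesis by (rule that)
qed

lemma labelling_block:
  assumes g: "\<And>i j. rel K7 (g i) (g j) \<longleftrightarrow> i = j" and "labelling g h s" "labelling g h' s'"
  shows "rel K7 (s p) (s' q) \<longleftrightarrow> fst p = fst q"
proof -
  have "rel K7 (g (fst p)) (s p)" "rel K7 (g (fst q)) (s' q)"
    using assms(2,3) unfolding labelling_def by blast+
  then have "rel K7 (s p) (s' q) \<longleftrightarrow> rel K7 (g (fst p)) (g (fst q))"
    using equivp_symp[OF K7(1)] equivp_transp[OF K7(1)] by metis
  then show ?thesis using g by simp
qed

text \<open>Only colours 0 to 3 occur inside a half, and colour 1 is excluded because one vertex per
  antipodal pair is chosen.\<close>

lemma labelling_col:
  assumes g: "\<And>i j. rel K7 (g i) (g j) \<longleftrightarrow> i = j" and s: "labelling g h s"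
  shows "col (s p) (s q) = (if p = q then 0 else if fst p = fst q then 2 else 3)"
proof -
  have 3: "rel K3 (s p) (s q)"
    using s equivp_symp[OF K3(1)] equivp_transp[OF K3(1)] unfolding labelling_def by metis
  have 2: "rel K2 (s p) (s q) \<longleftrightarrow> fst p = fst q"
    using labelling_block[OF g s s] same_half_block[OF 3] by simp
  have 1: "rel K1 (s p) (s q) \<longleftrightarrow> p = q"
    using s unfolding labelling_def by blast
  show ?thesis using 1 2 3 col_eq_0_iff[of "s p" "s q"] by (auto simp: rel_def)
qed

text \<open>The mn antipodal pairs of the labelled vertices are disjoint, hence fill the 2mn
  vertices of the half. As \<open>f\<close> is constant on pairs and zero outside the half, the full
  sum counts each representative twice.\<close>

lemma half_sum:
  fixes s :: "'m::finite \<times> 'n::finite \<Rightarrow> 'x" and f :: "'x \<Rightarrow> real"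
  assumes s: "labelling g h s" and card: "CARD('m) = m" "CARD('n) = n"
    and f: "\<And>y y'. col y y' = 1 \<Longrightarrow> f y' = f y"
    and supp: "\<And>y. \<not> rel K3 h y \<Longrightarrow> f y = 0"
  shows "(\<Sum>p\<in>UNIV. f (s p)) = (\<Sum>y\<in>UNIV. f y) / 2"
proof -
  let ?C = "\<lambda>p. {y. rel K1 (s p) y}"
  have disj: "?C p \<inter> ?C q = {}" if "p \<noteq> q" for p q
    using that s equivp_symp[OF K1(1)] equivp_transp[OF K1(1)] unfolding labelling_def by blast
  have sub: "(\<Union>p. ?C p) \<subseteq> {y. rel K3 h y}"
  proof
    fix y assume "y \<in> (\<Union>p. ?C p)"
    then obtain p where "rel K3 (s p) y" by (auto simp: rel_def)
    then show "y \<in> {y. rel K3 h y}"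
      using s equivp_transp[OF K3(1)] unfolding labelling_def by (metis mem_Collect_eq)
  qed
  have "card (\<Union>p. ?C p) = (\<Sum>p\<in>UNIV. card (?C p))"
    by (rule card_UN_disjoint) (use disj in auto)
  also have "\<dots> = card {y. rel K3 h y}"
    by (simp only: K1(2) K3(2)) (simp add: card)
  finally have H: "(\<Union>p. ?C p) = {y. rel K3 h y}"
    using sub by (intro card_subset_eq) auto
  have "(\<Sum>y\<in>UNIV. f y) = (\<Sum>y\<in>{y. rel K3 h y}. f y)"
    by (rule sum.mono_neutral_right) (use supp in auto)
  also have "\<dots> = (\<Sum>p\<in>UNIV. \<Sum>y\<in>?C p. f y)"
    unfolding H[symmetric] by (rule sum.UNION_disjoint) (use disj in auto)
  also have "\<dots> = (\<Sum>p\<in>UNIV. \<Sum>y\<in>?C p. f (s p))"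
  proof (intro sum.cong refl)
    fix p y assume "y \<in> ?C p"
    then have "col (s p) y = 0 \<or> col (s p) y = 1" by (auto simp: rel_def)
    then show "f y = f (s p)" using f[of "s p" y] col_eq_0_iff by auto
  qed
  also have "\<dots> = 2 * (\<Sum>p\<in>UNIV. f (s p))"
    by (simp add: K1(2) sum_distrib_left)
  finally show ?thesis by simp
qed

lemma f4_same_half: "rel K3 x y \<Longrightarrow> f4 (col x y) = 0"
  and f5_same_half: "rel K3 x y \<Longrightarrow> f5 (col x y) = 0"
  by (auto simp: rel_def)

section \<open>Construction of the weighing matrix\<close>

theorem weighing_matrix_exists:
  assumes card: "CARD('m::finite) = m" "CARD('n::finite) = n"
  shows "\<exists>W :: real ^ ('m \<times> 'n) ^ ('m \<times> 'n).
    weighing_matrix k W \<and> quasi_balanced W \<and>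
    (\<exists>l1 l2 :: nat. symmetric_gdd (m * n) k m n l1 l2 \<bar>W\<bar>) \<and>
    \<bar>W\<bar> ** block_J = (real k / mu) *\<^sub>R (all_ones - block_J) \<and>
    block_J ** \<bar>W\<bar> = (real k / mu) *\<^sub>R (all_ones - block_J)"
proof -
  obtain g :: "'m \<Rightarrow> 'x" where g: "\<And>i j. rel K7 (g i) (g j) \<longleftrightarrow> i = j"
    by (rule transversal_exists[OF K7(1), of UNIV "4 * n"]) (use n2 card in \<open>auto simp: K7(2) card_UNIV\<close>)
  fix h :: 'x
  \<comment> \<open>A half has only 2mn of the 4mn vertices, so \<open>h'\<close> can be taken in
    the other half.\<close>
  have "{y. rel K3 h y} \<noteq> UNIV"
    using K3(2)[of h] card_UNIV m2 n2 by auto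
  then obtain h' where h': "\<not> rel K3 h h'" by auto
  obtain r :: "'m \<times> 'n \<Rightarrow> 'x" where r: "labelling g h r"
    using labelling_exists[OF g card(2)] by blast
  obtain s :: "'m \<times> 'n \<Rightarrow> 'x" where s: "labelling g h' s"
    using labelling_exists[OF g card(2)] by blast
  have hr: "rel K3 h (r p)" and hs: "rel K3 h' (s p)" for p
    using r s unfolding labelling_def by blast+
  have far: "rel K3 (r p) y" if "\<not> rel K3 h' y" for p y
    using only_two_halves[OF h' that] hr equivp_symp[OF K3(1)] equivp_transp[OF K3(1)] by metis
  have far': "rel K3 (s p) y" if "\<not> rel K3 h y" for p y
    using only_two_halves[of h' h y] that h' hs equivp_symp[OF K3(1)] equivp_transp[OF K3(1)] by metis
  have rs: "\<not> rel K3 (r p) (s q)" for p q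
    using h' hr[of p] hs[of q] equivp_symp[OF K3(1)] equivp_transp[OF K3(1)] by metis
  \<comment> \<open>Between the halves only colours 4 to 7 occur, and colour 7 means that the groups
    are matched, hence have equal first labels.\<close>
  have rs456: "of_bool (col (r p) (s q) \<in> {4, 5, 6}) = (1 - of_bool (fst p = fst q) :: real)" for p q
    using labelling_block[OF g r s, of p q] rs[of p q] col_le[of "r p" "s q"]
    by (auto simp: rel_def)
  define W :: "real ^ ('m \<times> 'n) ^ ('m \<times> 'n)" where "W = (\<chi> p q. f4 (col (r p) (s q)))"
  have W: "W $ p $ q = f4 (col (r p) (s q))" for p q by (simp add: W_def)
  have absW: "\<bar>W\<bar> $ p $ q = f5 (col (r p) (s q))" for p q
    by (simp add: abs_mat_nth W)
  have B: "block_J $ p $ q = of_bool (fst p = fst q)" for p q :: "'m \<times> 'n"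
    by (simp add: block_J_def kronecker_mat_def mat_def all_ones_def)
  have "(\<Sum>q\<in>UNIV. f4 (col (r p) (s q)) * f4 (col (s q) (r p'))) = real k * of_bool (p = p')" for p p'
  proof -
    \<comment> \<open>Passing to the antipode of \<open>y\<close> changes both signs, so the product
      is constant on antipodal pairs. It vanishes for \<open>y\<close> in the half of
      \<open>h\<close>, where \<open>f4 (col (r p) y)\<close> is 0.\<close>
    have "(\<Sum>q\<in>UNIV. f4 (col (r p) (s q)) * f4 (col (s q) (r p'))) =
      (\<Sum>y\<in>UNIV. f4 (col (r p) y) * f4 (col y (r p'))) / 2"
      by (rule half_sum[OF s card]) (simp only: f4_mate f4_sym_mate minus_mult_minus, metis f4_same_half far mult_zero_left)
    then show ?thesis by (simp only: f4_square) (simp add: labelling_col[OF g r])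
  qed
  then have WW: "weighing_matrix k W"
    by (auto simp: weighing_matrix_def W vec_eq_iff matrix_matrix_mult_def transpose_def mat_def col_sym[of _ "r _"])
  have MM: "(\<Sum>q\<in>UNIV. f5 (col (r p) (s q)) * f5 (col (s q) (r p'))) =
      (if p = p' then real k else if fst p = fst p' then alpha else beta)" for p p'
  proof -
    have "(\<Sum>q\<in>UNIV. f5 (col (r p) (s q)) * f5 (col (s q) (r p'))) =
      (\<Sum>y\<in>UNIV. f5 (col (r p) y) * f5 (col y (r p'))) / 2"
      by (rule half_sum[OF s card]) (simp only: f5_mate f5_sym_mate, metis f5_same_half far mult_zero_left)
    then show ?thesis by (simp only: f5_square) (simp add: labelling_col[OF g r])
  qed
  have MM': "(\<Sum>p\<in>UNIV. f5 (col (s q) (r p)) * f5 (col (r p) (s q'))) =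
      (if q = q' then real k else if fst q = fst q' then alpha else beta)" for q q'
  proof -
    have "(\<Sum>p\<in>UNIV. f5 (col (s q) (r p)) * f5 (col (r p) (s q'))) =
      (\<Sum>y\<in>UNIV. f5 (col (s q) y) * f5 (col y (s q'))) / 2"
      by (rule half_sum[OF r card]) (simp only: f5_mate f5_sym_mate, metis f5_same_half far' mult_zero_left)
    then show ?thesis by (simp only: f5_square) (simp add: labelling_col[OF g s])
  qed
  \<comment> \<open>The sum counts common neighbours; evaluated at suitable pairs of rows it shows
    that \<open>alpha\<close> and \<open>beta\<close> are natural numbers.\<close>
  have nat_entry: "\<exists>l :: nat. (\<Sum>q\<in>UNIV. f5 (col (r p) (s q)) * f5 (col (s q) (r p'))) = real l" for p p'
    by (simp only: of_bool_conj[symmetric]) auto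
  obtain i i' :: 'm where i: "i \<noteq> i'"
    using card(1) m2 by (metis card_2_iff' ex_card subset_UNIV)
  obtain j j' :: 'n where j: "j \<noteq> j'"
    using card(2) n2 by (metis card_2_iff' ex_card subset_UNIV)
  obtain l1 :: nat where l1: "alpha = real l1"
    using nat_entry[of "(i, j)" "(i, j')"] MM[of "(i, j)" "(i, j')"] j by auto
  obtain l2 :: nat where l2: "beta = real l2"
    using nat_entry[of "(i, j)" "(i', j)"] MM[of "(i, j)" "(i', j)"] i by auto
  let ?R = "real k *\<^sub>R mat 1 + real l1 *\<^sub>R (block_J - mat 1) + real l2 *\<^sub>R (all_ones - block_J)
    :: real ^ ('m \<times> 'n) ^ ('m \<times> 'n)"
  have R: "?R $ p $ q = (if p = q then real k else if fst p = fst q then real l1 else real l2)" for p q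
    by (simp add: B mat_def all_ones_def)
  have AAt: "\<bar>W\<bar> ** transpose \<bar>W\<bar> = ?R"
    unfolding vec_eq_iff R using MM
    by (simp add: matrix_matrix_mult_def transpose_def absW l1 l2 col_sym[of "s _"])
  have AtA: "transpose \<bar>W\<bar> ** \<bar>W\<bar> = ?R"
    unfolding vec_eq_iff R using MM'
    by (simp add: matrix_matrix_mult_def transpose_def absW l1 l2 col_sym[of "s _"])
  have gdd: "symmetric_gdd (m * n) k m n l1 l2 \<bar>W\<bar>"
    using AAt AtA card m2 n2 by (simp add: symmetric_gdd_def absW)
  have "{?R $ p $ q | p q. p \<noteq> q} \<subseteq> {real l1, real l2}"
    by (auto simp only: R split: if_splits)
  then have "card {?R $ p $ q | p q. p \<noteq> q} \<le> card {real l1, real l2}"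
    by (intro card_mono) auto
  also have "\<dots> \<le> 2" by (simp add: card_insert_if)
  finally have qb: "quasi_balanced W"
    unfolding quasi_balanced_def AAt AtA by simp
  have "(\<Sum>q\<in>UNIV. f5 (col (r p) (s q)) * of_bool (fst q = fst q')) = real k / mu * (1 - of_bool (fst p = fst q'))" for p q' :: "'m \<times> 'n"
  proof -
    \<comment> \<open>Among the vertices \<open>s q\<close>, equal first labels mean the same class
      of \<open>K2\<close>, so the block indicator extends to all vertices and \<open>f5_K2\<close>
      applies.\<close>
    have "(\<Sum>q\<in>UNIV. f5 (col (r p) (s q)) * of_bool (fst q = fst q')) =
      (\<Sum>q\<in>UNIV. f5 (col (r p) (s q)) * of_bool (col (s q) (s q') \<in> K2))"
      by (intro sum.cong refl) (simp add: labelling_col[OF g s])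
    also have "\<dots> = (\<Sum>y\<in>UNIV. f5 (col (r p) y) * of_bool (col y (s q') \<in> K2)) / 2"
      by (rule half_sum[OF s card])
        (simp only: f5_sym_mate K2_mate[unfolded rel_def], metis f5_same_half far mult_zero_left)
    finally show ?thesis by (simp only: f5_K2 rs456) simp
  qed
  then have AB: "\<bar>W\<bar> ** block_J = (real k / mu) *\<^sub>R (all_ones - block_J)"
    by (simp add: vec_eq_iff matrix_matrix_mult_def absW B all_ones_def)
  have "(\<Sum>p'\<in>UNIV. of_bool (fst p = fst p') * f5 (col (r p') (s q))) = real k / mu * (1 - of_bool (fst p = fst q))" for p q :: "'m \<times> 'n"
  proof -
    have "(\<Sum>p'\<in>UNIV. of_bool (fst p = fst p') * f5 (col (r p') (s q))) =
      (\<Sum>p'\<in>UNIV. f5 (col (s q) (r p')) * of_bool (col (r p') (r p) \<in> K2))"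
      by (intro sum.cong refl) (simp add: labelling_col[OF g r] col_sym[of "s q"])
    also have "\<dots> = (\<Sum>y\<in>UNIV. f5 (col (s q) y) * of_bool (col y (r p) \<in> K2)) / 2"
      by (rule half_sum[OF r card])
        (simp only: f5_sym_mate K2_mate[unfolded rel_def], metis f5_same_half far' mult_zero_left)
    finally show ?thesis by (simp only: f5_K2 col_sym[of "s q" "r p"] rs456) simp
  qed
  then have BA: "block_J ** \<bar>W\<bar> = (real k / mu) *\<^sub>R (all_ones - block_J)"
    by (simp add: vec_eq_iff matrix_matrix_mult_def absW B all_ones_def)
  show ?thesis using WW qb gdd AB BA by blast
qed

end

theorem theorem4p6:
  fixes m n k :: nat
    and A E :: "nat \<Rightarrow> complex ^ 'x ^ 'x::finite"
  assumes m: "m \<ge> 2" "CARD('m::finite) = m"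
    and n: "n \<ge> 2" "CARD('n::finite) = n"
    and k: "k \<ge> 1" "m * n > k"
    and scheme: "symmetric_association_scheme 7 A"
    and idempotents: "primitive_idempotent_basis 7 A E"
    and P: "first_eigenmatrix 7 A E (table_entry (P_rows (real m) (real n) (real k)))"
    and Q: "second_eigenmatrix 7 A E (table_entry (Q_rows (real m) (real n) (real k)))"
  shows "\<exists>W :: real ^ ('m \<times> 'n) ^ ('m \<times> 'n).
    weighing_matrix k W \<and> quasi_balanced W \<and>
    (\<exists>l1 l2 :: nat. symmetric_gdd (m * n) k m n l1 l2 \<bar>W\<bar>) \<and>
    \<bar>W\<bar> ** block_J = (real k / (real m - 1)) *\<^sub>R (all_ones - block_J) \<and>
    block_J ** \<bar>W\<bar> = (real k / (real m - 1)) *\<^sub>R (all_ones - block_J)"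
proof -
  have "first_eigenmatrix 7 A E (\<lambda>i j. complex_of_real (P_rows (real m) (real n) (real k) ! i ! j))"
    using P by (simp add: first_eigenmatrix_def table_entry_def)
  then obtain col :: "'x \<Rightarrow> 'x \<Rightarrow> nat"
    where "eigen_colouring 7 col (\<lambda>i j. P_rows (real m) (real n) (real k) ! i ! j)"
    by (rule eigen_colouring_exists[OF scheme idempotents])
  then interpret weighing_scheme col m n k
    using m(1) n(1) k(1) by (intro weighing_scheme.intro weighing_scheme_axioms.intro)
  show ?thesis
    using weighing_matrix_exists[OF m(2) n(2)] by (simp only: mu_def)
qed

end
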